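(* Let $F$ be a finite field, $\Gamma$ a nonempty set, $\varphi:\Gamma\to\Gamma$ a self-map, $\mathfrak{w}=(\mathfrak{w}_\alpha)_{\alpha\in\Gamma}\in F^\Gamma$, and let $\sigma_{\varphi,\mathfrak{w}}:F^\Gamma\to F^\Gamma$, $\sigma_{\varphi,\mathfrak{w}}((x_\alpha)_{\alpha\in\Gamma})=(\mathfrak{w}_\alpha x_{\varphi(\alpha)})_{\alpha\in\Gamma}$. Put $\mathrm{supp}(\mathfrak{w})=\{\alpha\in\Gamma:\mathfrak{w}_\alpha\neq0\}$. The following statements are equivalent: 1. $\sigma_{\varphi,\mathfrak{w}}:F^\Gamma\to F^\Gamma$ is of finite fibre; 2. $\Gamma\setminus\varphi(\mathrm{supp}(\mathfrak{w}))$ is finite; 3. there exists $N\geq1$ such that $|\sigma_{\varphi,\mathfrak{w}}^{-1}(x)|\leq N$ for each $x\in F^\Gamma$. In particular, if $\mathfrak{w}_\alpha\neq0$ for each $\alpha\in\Gamma$, then the following are equivalent: (i) $\sigma_{\varphi,\mathfrak{w}}:F^\Gamma\to F^\Gamma$ is of finite fibre; (ii) $\sigma_\varphi:F^\Gamma\to F^\Gamma$ is of finite fibre; (iii) $\Gamma\setminus\varphi(\Gamma)$ is a finite set.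
   Context: A map $f:A\to B$ is of finite fibre if $f^{-1}(y)$ is finite for all $y\in B$. The generalized shift is $\sigma_\varphi:F^\Gamma\to F^\Gamma$, $\sigma_\varphi((x_\alpha)_{\alpha\in\Gamma})=(x_{\varphi(\alpha)})_{\alpha\in\Gamma}$. *)

theory Defs
  imports "HOL-Analysis.Analysis"
begin

definition finite_fibre :: "('a \<Rightarrow> 'b) \<Rightarrow> bool" where
  "finite_fibre f \<longleftrightarrow> (\<forall>y. finite (f -` {y}))"

definition gen_shift :: "('g \<Rightarrow> 'g) \<Rightarrow> ('g \<Rightarrow> 'f) \<Rightarrow> ('g \<Rightarrow> 'f)" where
  "gen_shift \<phi> x = (\<lambda>\<alpha>. x (\<phi> \<alpha>))"

definition weighted_gen_shift ::
  "('g \<Rightarrow> 'g) \<Rightarrow> ('g \<Rightarrow> 'f::times) \<Rightarrow> ('g \<Rightarrow> 'f) \<Rightarrow> ('g \<Rightarrow> 'f)" where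
  "weighted_gen_shift \<phi> w x = (\<lambda>\<alpha>. w \<alpha> * x (\<phi> \<alpha>))"

end

theory Submission
  imports Defs
begin

text \<open>
  The equation \<open>w \<alpha> * x (\<phi> \<alpha>) = y \<alpha>\<close> determines \<open>x\<close> on the image under \<open>\<phi>\<close> of the support of \<open>w\<close>
  and says nothing about \<open>x\<close> on the complement \<open>T\<close> of that image. Hence a fibre embeds, by restriction,
  into the functions on \<open>T\<close>, while the fibre of zero contains the indicators of the points of \<open>T\<close>.
\<close>

text \<open>Each \<beta> outside T is \<phi> \<alpha> for some \<alpha> with w \<alpha> nonzero.
  Cancelling w \<alpha> in the field shows that two members of one fibre agree at \<beta>, so they
  can differ only on T.\<close>

lemma inj_on_restrict_weighted_gen_shift_fibre:
  fixes w :: "'g \<Rightarrow> 'f::field"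
  shows "inj_on (\<lambda>x. restrict x (UNIV - \<phi> ` support_on UNIV w)) (weighted_gen_shift \<phi> w -` {y})"
proof (rule inj_onI)
  fix x x'
  let ?T = "UNIV - \<phi> ` support_on UNIV w"
  assume x: "x \<in> weighted_gen_shift \<phi> w -` {y}" and x': "x' \<in> weighted_gen_shift \<phi> w -` {y}"
    and eq: "restrict x ?T = restrict x' ?T"
  show "x = x'"
  proof
    fix \<beta>
    show "x \<beta> = x' \<beta>"
    proof (cases "\<beta> \<in> ?T")
      case True
      then show ?thesis using eq by (metis restrict_apply')
    next
      case False
      then obtain \<alpha> where \<alpha>: "\<beta> = \<phi> \<alpha>" "w \<alpha> \<noteq> 0" by (auto simp: support_on_def)
      have "weighted_gen_shift \<phi> w x \<alpha> = weighted_gen_shift \<phi> w x' \<alpha>" using x x' by simp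
      then show ?thesis using \<alpha> by (simp add: weighted_gen_shift_def)
    qed
  qed
qed

text \<open>The bound does not depend on \<open>y\<close>, so finiteness of T yields finite fibres
  and a uniform bound at once.\<close>

lemma weighted_gen_shift_fibre_bound:
  fixes w :: "'g \<Rightarrow> 'f::{field,finite}"
  assumes "finite (UNIV - \<phi> ` support_on UNIV w)"
  shows "finite (weighted_gen_shift \<phi> w -` {y})"
    and "card (weighted_gen_shift \<phi> w -` {y}) \<le> CARD('f) ^ card (UNIV - \<phi> ` support_on UNIV w)"
proof -
  let ?T = "UNIV - \<phi> ` support_on UNIV w"
  \<comment> \<open>Extensional functions take a fixed value off T, so they form a finite set, and
    \<open>restrict\<close> lands in it.\<close>
  let ?P = "?T \<rightarrow>\<^sub>E (UNIV :: 'f set)"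
  have fin: "finite ?P" using assms by (intro finite_PiE) simp_all
  have sub: "(\<lambda>x. restrict x ?T) ` (weighted_gen_shift \<phi> w -` {y}) \<subseteq> ?P" by auto
  note inj = inj_on_restrict_weighted_gen_shift_fibre[of \<phi> w y]
  show "finite (weighted_gen_shift \<phi> w -` {y})"
    by (rule inj_on_finite[OF inj sub fin])
  show "card (weighted_gen_shift \<phi> w -` {y}) \<le> CARD('f) ^ card ?T"
    using card_inj_on_le[OF inj sub fin] assms by (simp add: card_PiE)
qed

lemma finite_fibre_weighted_gen_shift_iff:
  fixes w :: "'g \<Rightarrow> 'f::{field,finite}"
  shows "finite_fibre (weighted_gen_shift \<phi> w) \<longleftrightarrow> finite (UNIV - \<phi> ` support_on UNIV w)"
proof
  let ?T = "UNIV - \<phi> ` support_on UNIV w"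
  let ?e = "\<lambda>\<beta> \<gamma>. if \<gamma> = \<beta> then 1 else 0 :: 'f"
  assume "finite_fibre (weighted_gen_shift \<phi> w)"
  then have "finite (weighted_gen_shift \<phi> w -` {\<lambda>_. 0})" by (simp add: finite_fibre_def)
  \<comment> \<open>At each \<alpha>, either w \<alpha> = 0, or \<phi> \<alpha> lies in the image of
    the support and so differs from every \<beta> in T; the product vanishes in both cases.\<close>
  moreover have "?e ` ?T \<subseteq> weighted_gen_shift \<phi> w -` {\<lambda>_. 0}"
    by (auto simp: weighted_gen_shift_def support_on_def fun_eq_iff)
  moreover have "inj_on ?e ?T"
    by (intro inj_onI) (metis zero_neq_one)
  ultimately show "finite ?T" by (metis inj_on_finite)
next
  assume "finite (UNIV - \<phi> ` support_on UNIV w)"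
  then show "finite_fibre (weighted_gen_shift \<phi> w)"
    unfolding finite_fibre_def using weighted_gen_shift_fibre_bound(1) by blast
qed

text \<open>The constant weight 1 has full support, so the criterion for weighted shifts specializes
  to the unweighted one.\<close>

lemma gen_shift_eq_weighted_gen_shift:
  "(gen_shift \<phi> :: ('g \<Rightarrow> 'f::monoid_mult) \<Rightarrow> _) = weighted_gen_shift \<phi> (\<lambda>_. 1)"
  by (simp add: fun_eq_iff gen_shift_def weighted_gen_shift_def)

theorem lemma4p8:
  fixes \<phi> :: "'g \<Rightarrow> 'g" and w :: "'g \<Rightarrow> 'f::{field,finite}"
  shows "(finite_fibre (weighted_gen_shift \<phi> w) \<longleftrightarrow>
            finite (UNIV - \<phi> ` support_on UNIV w)) \<and>
         (finite (UNIV - \<phi> ` support_on UNIV w) \<longleftrightarrow>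
            (\<exists>N::nat. N \<ge> 1 \<and>
               (\<forall>x. finite (weighted_gen_shift \<phi> w -` {x}) \<and>
                    card (weighted_gen_shift \<phi> w -` {x}) \<le> N))) \<and>
         ((\<forall>\<alpha>. w \<alpha> \<noteq> 0) \<longrightarrow>
            (finite_fibre (weighted_gen_shift \<phi> w) \<longleftrightarrow>
               finite_fibre (gen_shift \<phi> :: ('g \<Rightarrow> 'f) \<Rightarrow> 'g \<Rightarrow> 'f)) \<and>
            (finite_fibre (gen_shift \<phi> :: ('g \<Rightarrow> 'f) \<Rightarrow> 'g \<Rightarrow> 'f) \<longleftrightarrow>
               finite (UNIV - range \<phi>)))"
proof (intro conjI impI)
  let ?T = "UNIV - \<phi> ` support_on UNIV w"
  show "finite_fibre (weighted_gen_shift \<phi> w) \<longleftrightarrow> finite ?T"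
    by (rule finite_fibre_weighted_gen_shift_iff)
  show "finite ?T \<longleftrightarrow> (\<exists>N::nat. N \<ge> 1 \<and>
      (\<forall>x. finite (weighted_gen_shift \<phi> w -` {x}) \<and> card (weighted_gen_shift \<phi> w -` {x}) \<le> N))"
    (is "_ \<longleftrightarrow> ?bounded")
  proof
    assume fin: "finite ?T"
    \<comment> \<open>This power is the witness for N; it is positive because \<open>'f\<close> is
      finite and nonempty.\<close>
    have "1 \<le> CARD('f) ^ card ?T" by (simp add: Suc_le_eq)
    with weighted_gen_shift_fibre_bound[OF fin] show ?bounded by blast
  next
    assume ?bounded
    \<comment> \<open>The finiteness clause of \<open>?bounded\<close> is what gives finite fibres:
      \<open>card\<close> is 0 on infinite sets, so a bound on it could not exclude them.\<close>
    then show "finite ?T"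
      by (auto simp: finite_fibre_weighted_gen_shift_iff[symmetric] finite_fibre_def)
  qed
  have gen: "finite_fibre (gen_shift \<phi> :: ('g \<Rightarrow> 'f) \<Rightarrow> 'g \<Rightarrow> 'f) \<longleftrightarrow> finite (UNIV - range \<phi>)"
    by (simp add: gen_shift_eq_weighted_gen_shift finite_fibre_weighted_gen_shift_iff support_on_def)
  then show "finite_fibre (gen_shift \<phi> :: ('g \<Rightarrow> 'f) \<Rightarrow> 'g \<Rightarrow> 'f) \<longleftrightarrow> finite (UNIV - range \<phi>)" .
  assume "\<forall>\<alpha>. w \<alpha> \<noteq> 0"
  \<comment> \<open>With full support, T becomes the complement of \<open>range \<phi>\<close>, the
    same set as for the unweighted shift.\<close>
  then have "support_on UNIV w = UNIV" by (simp add: support_on_def)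
  then show "finite_fibre (weighted_gen_shift \<phi> w) \<longleftrightarrow>
      finite_fibre (gen_shift \<phi> :: ('g \<Rightarrow> 'f) \<Rightarrow> 'g \<Rightarrow> 'f)"
    by (simp add: gen finite_fibre_weighted_gen_shift_iff)
qed

end
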